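(* Let $\mathbf{d}:[0,1)^2\to\mathbb{R}$ be a dissimilarity that is continuous and strict circular Robinson, and let $\pi\in\operatorname{Sym}(\infty)$. If the dissimilarity $(u,v)\mapsto\mathbf{d}(\pi(u),\pi(v))$ is strict circular Robinson, then $\pi\in\operatorname{Dih}_\infty$.
   Context: $[0,1)$ is identified with the unit circle via $t\mapsto e^{2\pi i t}$ (so $0$ and $1$ are identified), which gives its topology and its natural cyclic order. Points $x,y,z,w\in[0,1)$ are cyclically ordered if pairwise distinct and $(y-x\bmod 1)<(z-x\bmod 1)<(w-x\bmod 1)$. A dissimilarity on $[0,1)$ is a nonnegative symmetric function vanishing on the diagonal; it is strict circular Robinson if $\mathbf{d}(y,w)>\min\{\mathbf{d}(y,x),\mathbf{d}(y,z)\}$ for all cyclically ordered $x,y,z,w$. For $s\in[0,1)$ let $\pi_s(t)=t+s\bmod 1$, and let $\pi_r(t)=1-t\bmod 1$; $\operatorname{Dih}_\infty$ is the group of bijections of $[0,1)$ generated by $\pi_r$ and all $\pi_s$. For $t\ne s$, the arc $\mathcal{I}=(t,s)$ is the set of points strictly between $t$ and $s$ going forward from $t$; $\sigma_{\mathcal{I}}$ is the bijection reversing $\mathcal{I}$ and fixing $\mathcal{I}^c$, i.e. $\sigma_{\mathcal{I}}(t+u\bmod 1)=s-u\bmod 1$ for $0<u<(s-t\bmod 1)$. $\operatorname{Sym}(\infty)=\{\rho\circ g:\rho\in\operatorname{Dih}_\infty,\ g\in\langle\sigma_{\mathcal{I}}:\mathcal{I}\text{ an arc}\rangle\}$. *)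

theory Defs
  imports "HOL-Analysis.Analysis" "HOL-Algebra.Bij" "HOL-Algebra.Generated_Groups"
begin

section \<open>The circle as the interval [0,1)\<close>

text \<open>The library function \<^const>\<open>frac\<close> is reduction modulo 1, with values in [0,1).\<close>

abbreviation circ :: "real set" where
  "circ \<equiv> {0..<1}"

text \<open>The topology that makes the bijection \<open>t \<mapsto> exp (2\<pi>\<i>t)\<close> onto the unit circle a homeomorphism; it is
  strictly coarser than the subspace topology of \<^term>\<open>{0..<1::real}\<close>.\<close>

definition circ_topology :: "real topology" where
  "circ_topology =
     pullback_topology circ (\<lambda>t. exp (2 * of_real pi * \<i> * of_real t) :: complex) euclidean"

definition cyclically_ordered :: "real \<Rightarrow> real \<Rightarrow> real \<Rightarrow> real \<Rightarrow> bool" where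
  "cyclically_ordered x y z w \<longleftrightarrow>
     distinct [x, y, z, w] \<and> frac (y - x) < frac (z - x) \<and> frac (z - x) < frac (w - x)"


section \<open>Dissimilarities\<close>

text \<open>All predicates below only constrain \<^term>\<open>d\<close> on \<^term>\<open>circ \<times> circ\<close>.\<close>

definition dissimilarity :: "(real \<Rightarrow> real \<Rightarrow> real) \<Rightarrow> bool" where
  "dissimilarity d \<longleftrightarrow>
     (\<forall>x\<in>circ. \<forall>y\<in>circ. 0 \<le> d x y \<and> d x y = d y x) \<and> (\<forall>x\<in>circ. d x x = 0)"

definition continuous_dissimilarity :: "(real \<Rightarrow> real \<Rightarrow> real) \<Rightarrow> bool" where
  "continuous_dissimilarity d \<longleftrightarrow> dissimilarity d \<and>
     continuous_map (prod_topology circ_topology circ_topology) euclideanreal (\<lambda>(x, y). d x y)"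

definition strict_circular_Robinson :: "(real \<Rightarrow> real \<Rightarrow> real) \<Rightarrow> bool" where
  "strict_circular_Robinson d \<longleftrightarrow> dissimilarity d \<and>
     (\<forall>x\<in>circ. \<forall>y\<in>circ. \<forall>z\<in>circ. \<forall>w\<in>circ.
        cyclically_ordered x y z w \<longrightarrow> d y w > min (d y x) (d y z))"


section \<open>The groups\<close>

text \<open>Bijections of [0,1) are represented, as in \<^const>\<open>BijGroup\<close>, by functions that are
  \<^const>\<open>undefined\<close> off [0,1); composition is \<^term>\<open>compose circ\<close>.\<close>

definition rotation :: "real \<Rightarrow> real \<Rightarrow> real" where
  "rotation s = (\<lambda>t\<in>circ. frac (t + s))"

definition reflection :: "real \<Rightarrow> real" where
  "reflection = (\<lambda>t\<in>circ. frac (1 - t))"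

definition Dih_infty :: "(real \<Rightarrow> real) set" where
  "Dih_infty = generate (BijGroup circ) (insert reflection (rotation ` circ))"

definition circ_arc :: "real \<Rightarrow> real \<Rightarrow> real set" where
  "circ_arc t s = {frac (t + u) |u. 0 < u \<and> u < frac (s - t)}"

text \<open>For \<open>x = frac (t + u)\<close> in the arc, \<open>u = frac (x - t)\<close>; see \<open>arc_reversal_param\<close>.\<close>

definition arc_reversal :: "real \<Rightarrow> real \<Rightarrow> real \<Rightarrow> real" where
  "arc_reversal t s =
     (\<lambda>x\<in>circ. if x \<in> circ_arc t s then frac (s - frac (x - t)) else x)"

definition Sym_infty :: "(real \<Rightarrow> real) set" where
  "Sym_infty = {compose circ \<rho> g |\<rho> g. \<rho> \<in> Dih_infty \<and>
     g \<in> generate (BijGroup circ) {arc_reversal t s |t s. t \<in> circ \<and> s \<in> circ \<and> t \<noteq> s}}"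


section \<open>The definitions are as intended\<close>

lemma frac_cong: "x - y \<in> \<int> \<Longrightarrow> frac x = frac (y::real)"
proof -
  assume "x - y \<in> \<int>"
  then obtain n where "x - y = of_int n" by (auto elim: Ints_cases)
  then have "x = y + of_int n" by simp
  then show ?thesis by (simp add: frac_def)
qed

lemma frac_in_circ: "frac x \<in> circ"
  by (simp add: frac_ge_0 frac_lt_1)

lemma frac_circ: "x \<in> circ \<Longrightarrow> frac x = x"
  by (simp add: frac_eq)

lemma topspace_circ_topology: "topspace circ_topology = circ"
  by (simp add: circ_topology_def topspace_pullback_topology)

lemma rotation_Bij: "rotation s \<in> Bij circ"
proof -
  have "bij_betw (\<lambda>t. frac (t + s)) circ circ"
  proof (rule bij_betw_byWitness[where f' = "\<lambda>t. frac (t - s)"])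
    show "\<forall>a\<in>circ. frac (frac (a + s) - s) = a"
    proof
      fix a :: real assume a: "a \<in> circ"
      have "frac (frac (a + s) - s) = frac a"
        by (rule frac_cong) (simp add: frac_def)
      then show "frac (frac (a + s) - s) = a" using a frac_circ by simp
    qed
    show "\<forall>a\<in>circ. frac (frac (a - s) + s) = a"
    proof
      fix a :: real assume a: "a \<in> circ"
      have "frac (frac (a - s) + s) = frac a"
        by (rule frac_cong) (simp add: frac_def)
      then show "frac (frac (a - s) + s) = a" using a frac_circ by simp
    qed
  qed (use frac_in_circ in auto)
  then show ?thesis
    by (simp add: Bij_def rotation_def bij_betw_restrict_eq)
qed

lemma reflection_Bij: "reflection \<in> Bij circ"
proof -
  have "bij_betw (\<lambda>t. frac (1 - t)) circ circ"
  proof (rule bij_betw_byWitness[where f' = "\<lambda>t. frac (1 - t)"])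
    show inv: "\<forall>a\<in>circ. frac (1 - frac (1 - a)) = a"
    proof
      fix a :: real assume a: "a \<in> circ"
      have "frac (1 - frac (1 - a)) = frac a"
        by (rule frac_cong) (simp add: frac_def)
      then show "frac (1 - frac (1 - a)) = a" using a frac_circ by simp
    qed
    then show "\<forall>a\<in>circ. frac (1 - frac (1 - a)) = a" .
  qed (use frac_in_circ in auto)
  then show ?thesis
    by (simp add: Bij_def reflection_def bij_betw_restrict_eq)
qed

lemma arc_reversal_param:
  assumes "0 < u" "u < frac (s - t)"
  shows "arc_reversal t s (frac (t + u)) = frac (s - u)"
proof -
  have "frac (t + u) \<in> circ_arc t s"
    using assms by (auto simp: circ_arc_def)
  moreover have "frac (frac (t + u) - t) = frac u"
    by (rule frac_cong) (simp add: frac_def)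
  moreover have "frac u = u"
    using assms frac_lt_1[of "s - t"] by (intro frac_circ) auto
  ultimately show ?thesis
    using frac_in_circ by (simp add: arc_reversal_def)
qed

lemma arc_reversal_Bij: "arc_reversal t s \<in> Bij circ"
proof -
  have invol: "arc_reversal t s x \<in> circ \<and> arc_reversal t s (arc_reversal t s x) = x"
    if x: "x \<in> circ" for x
  proof (cases "x \<in> circ_arc t s")
    case True
    then obtain u where u: "x = frac (t + u)" "0 < u" "u < frac (s - t)"
      by (auto simp: circ_arc_def)
    define v where "v = frac (s - t) - u"
    have v: "0 < v" "v < frac (s - t)"
      using u by (auto simp: v_def)
    have 1: "frac (t + v) = frac (s - u)"
      by (rule frac_cong) (simp add: v_def frac_def)
    have 2: "frac (s - v) = frac (t + u)"
      by (rule frac_cong) (simp add: v_def frac_def)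
    have "arc_reversal t s x = frac (t + v)"
      using arc_reversal_param[OF u(2,3)] u(1) 1 by simp
    moreover have "arc_reversal t s (frac (t + v)) = x"
      using arc_reversal_param[OF v] u(1) 2 by simp
    ultimately show ?thesis
      using frac_in_circ by simp
  qed (use x in \<open>simp add: arc_reversal_def\<close>)
  have "bij_betw (arc_reversal t s) circ circ"
    by (rule bij_betw_byWitness[where f' = "arc_reversal t s"]) (use invol in auto)
  then show ?thesis
    by (simp add: Bij_def) (simp add: arc_reversal_def)
qed

end

theory Submission
  imports Defs
begin

text \<open>
  Write \<open>e u v = d (\<pi> u) (\<pi> v)\<close>. By the intermediate value theorem, \<open>d y\<close> attains every small positive
  value at least twice, on either side of its maximum; since \<open>\<pi>\<close> is a bijection, so does \<open>e u\<close>. If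
  \<open>e u\<close> takes the value \<open>\<delta>\<close> at \<open>u + t1\<close> and \<open>u + t2\<close>, the Robinson property of \<open>e\<close> forces
  \<open>e u < \<delta>\<close> on the arc from \<open>u + t2\<close> through \<open>u\<close> to \<open>u + t1\<close>. Hence \<open>e u v\<close> tends to 0 as \<open>v\<close> tends to
  \<open>u\<close>, so that \<open>\<pi>\<close> is continuous. On the other hand \<open>\<pi>\<close> is piecewise of the form \<open>t \<mapsto> c \<plusminus> t\<close>; by
  continuity and injectivity the pieces fit together to a single one.
\<close>

section \<open>Quasi-concavity and vanishing at the diagonal\<close>

lemma frac_eq_frac_iff: "frac x = frac y \<longleftrightarrow> x - y \<in> \<int>" for x y :: real
proof
  assume "frac x = frac y"
  then have "x - y = of_int (\<lfloor>x\<rfloor> - \<lfloor>y\<rfloor>)" by (simp add: frac_def algebra_simps)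
  then show "x - y \<in> \<int>" by simp
qed (rule frac_cong)

lemma frac_eqI:
  fixes a b :: real
  assumes "a - b \<in> \<int>" "0 \<le> b" "b < 1"
  shows "frac a = b"
  using assms by (simp add: frac_unique_iff)

lemma add_frac_diff: "x \<in> circ \<Longrightarrow> frac (y + frac (x - y)) = x"
  by (intro frac_eqI) (auto simp: frac_def)

text \<open>Reading the cyclic order from \<open>u + t3\<close> gives
  \<open>u + t3, u, u + t1, u + t2\<close>, with \<open>u\<close> in second place. The Robinson
  inequality then becomes strict quasi-concavity of the distance from \<open>u\<close> along one
  turn of the circle, the only form used below.\<close>

lemma strict_circular_Robinson_quasiconcave:
  assumes "strict_circular_Robinson e" "u \<in> circ" "0 < t1" "t1 < t2" "t2 < t3" "t3 < 1"
  shows "e u (frac (u + t2)) > min (e u (frac (u + t1))) (e u (frac (u + t3)))"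
proof -
  \<comment> \<open>\<open>c\<close> is the integer that corrects for the wrap-around: 1 where the
    point \<open>u\<close> is passed on the way from \<open>u + t3\<close>, 0 otherwise.\<close>
  have frac_diff_shift: "frac (frac (u + a) - frac (u + b)) = a - b + c"
    if "0 \<le> a - b + c" "a - b + c < 1" "c \<in> \<int>" for a b c
    by (rule frac_eqI) (use that in \<open>auto simp: frac_def\<close>)
  have 0: "frac (u + 0) = u" using assms(2) by simp
  have 1: "frac (u - frac (u + t3)) = 1 - t3"
    using frac_diff_shift[of 0 t3 1] 0 assms by auto
  have 2: "frac (frac (u + t1) - frac (u + t3)) = t1 - t3 + 1"
    using frac_diff_shift[of t1 t3 1] assms by auto
  have 3: "frac (frac (u + t2) - frac (u + t3)) = t2 - t3 + 1"
    using frac_diff_shift[of t2 t3 1] assms by auto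
  have dist: "frac (u + a) \<noteq> frac (u + b)" if "0 < b - a" "b - a < 1" for a b
    using frac_diff_shift[of b a 0] that by auto
  have d1: "u \<noteq> frac (u + t1)" "u \<noteq> frac (u + t2)" "u \<noteq> frac (u + t3)"
    using dist[of t1 0] dist[of t2 0] dist[of t3 0] 0 assms by force+
  have d2: "frac (u + t1) \<noteq> frac (u + t2)" "frac (u + t1) \<noteq> frac (u + t3)"
    "frac (u + t2) \<noteq> frac (u + t3)"
    using dist assms by auto
  have "cyclically_ordered (frac (u + t3)) u (frac (u + t1)) (frac (u + t2))"
    unfolding cyclically_ordered_def 1 2 3 using assms d1 d2 by auto
  with assms(1,2) have "e u (frac (u + t2)) > min (e u (frac (u + t3))) (e u (frac (u + t1)))"
    unfolding strict_circular_Robinson_def using frac_in_circ by blast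
  then show ?thesis by (simp add: min.commute)
qed

text \<open>Seen from \<open>y\<close>, the point \<open>w\<close> lies between two further points,
  so quasi-concavity puts \<open>d y w\<close> strictly above a minimum of nonnegative numbers. Thus
  \<open>d y\<close> detects equality with \<open>y\<close>.\<close>

lemma strict_circular_Robinson_pos:
  assumes d: "strict_circular_Robinson d" and "y \<in> circ" "w \<in> circ" "y \<noteq> w"
  shows "0 < d y w"
proof -
  define t where "t = frac (w - y)"
  have w: "frac (y + t) = w"
    unfolding t_def by (rule add_frac_diff[OF assms(3)])
  have "t \<noteq> 0"
    using w assms(2,4) by auto
  then have t: "0 < t" "t < 1"
    using frac_ge_0[of "w - y"] frac_lt_1[of "w - y"] by (auto simp: t_def simp del: frac_ge_0)
  have "d y (frac (y + t)) > min (d y (frac (y + t / 2))) (d y (frac (y + (t + 1) / 2)))"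
    by (rule strict_circular_Robinson_quasiconcave[OF d assms(2)]) (use t in auto)
  moreover have "0 \<le> d y (frac a)" for a
    using d assms(2) frac_in_circ[of a]
    unfolding strict_circular_Robinson_def dissimilarity_def by blast
  ultimately show ?thesis
    unfolding w by (smt (verit))
qed

text \<open>The exponential absorbs the integer shift, so \<open>frac\<close> is continuous from the
  line into the circle topology, even at integers. Continuity questions thereby move to the real
  line.\<close>

lemma continuous_dissimilarity_frac:
  assumes "continuous_dissimilarity d" "y \<in> circ"
  shows "continuous_on UNIV (\<lambda>t. d y (frac t))"
proof -
  have "exp (2 * of_real pi * \<i> * of_real (frac t)) = exp (2 * of_real pi * \<i> * of_real t)"
    for t :: real
    unfolding frac_def exp_eq by (rule exI[of _ "- \<lfloor>t\<rfloor>"]) (simp add: algebra_simps)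
  then have "(\<lambda>t. exp (2 * of_real pi * \<i> * of_real t)) \<circ> frac =
      (\<lambda>t::real. exp (2 * of_real pi * \<i> * of_real t) :: complex)"
    by (simp add: o_def)
  moreover have "continuous_on UNIV (\<lambda>t::real. exp (2 * of_real pi * \<i> * of_real t) :: complex)"
    by (intro continuous_intros)
  ultimately have "continuous_map euclideanreal circ_topology frac"
    unfolding circ_topology_def
    by (intro continuous_map_pullback') (use frac_in_circ in \<open>auto simp: frac_lt_1\<close>)
  then have "continuous_map euclideanreal (prod_topology circ_topology circ_topology) (\<lambda>t. (y, frac t))"
    using assms(2) by (intro continuous_map_pairedI) (auto simp: topspace_circ_topology)
  then have "continuous_map euclideanreal euclideanreal ((\<lambda>(x, y). d x y) \<circ> (\<lambda>t. (y, frac t)))"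
    using assms(1) unfolding continuous_dissimilarity_def by (intro continuous_map_compose) auto
  then show ?thesis by (simp add: o_def)
qed

text \<open>The intermediate value theorem applies on each side of \<open>m\<close>. As \<delta>
  lies strictly between 0 and \<open>f m\<close>, neither solution is an endpoint or
  \<open>m\<close>, so the two are distinct and interior.\<close>

lemma attains_small_values_twice:
  fixes f :: "real \<Rightarrow> real"
  assumes f: "continuous_on {0..1} f" and 0: "f 0 = 0" "f 1 = 0" and "0 < f m" "0 < m" "m < 1"
    and \<delta>: "0 < \<delta>" "\<delta> < f m"
  shows "\<exists>s1 s2. 0 < s1 \<and> s1 < s2 \<and> s2 < 1 \<and> f s1 = \<delta> \<and> f s2 = \<delta>"
proof -
  have "continuous_on {0..m} f" "continuous_on {m..1} f"
    using f by (rule continuous_on_subset; use assms in auto)+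
  then obtain s1 s2 where s: "0 \<le> s1" "s1 \<le> m" "f s1 = \<delta>" "m \<le> s2" "s2 \<le> 1" "f s2 = \<delta>"
    using IVT'[of f 0 \<delta> m] IVT2'[of f 1 \<delta> m] assms by auto
  moreover have "s1 \<noteq> 0" "s2 \<noteq> 1" "s1 \<noteq> m" "s2 \<noteq> m"
    using s assms by auto
  ultimately show ?thesis by (intro exI[of _ s1] exI[of _ s2]) auto
qed

text \<open>This is continuity of \<pi> measured by \<open>d\<close>. Continuity of \<open>d\<close>
  supplies two points at equal small distance from the image; bijectivity pulls them back, and
  quasi-concavity of the transported dissimilarity controls everything between them and
  \<open>x\<close>.\<close>

lemma strict_circular_Robinson_bij_vanishes:
  assumes cont: "continuous_dissimilarity d" and d: "strict_circular_Robinson d"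
    and \<pi>: "bij_betw \<pi> circ circ"
    and e: "strict_circular_Robinson (\<lambda>u v. d (\<pi> u) (\<pi> v))"
    and \<delta>: "0 < \<delta>"
  shows "\<exists>\<epsilon>>0. \<forall>h. 0 < \<bar>h\<bar> \<and> \<bar>h\<bar> < \<epsilon> \<longrightarrow> d (\<pi> (frac x)) (\<pi> (frac (x + h))) < \<delta>"
proof -
  define u where "u = frac x"
  define y where "y = \<pi> u"
  have u: "u \<in> circ" unfolding u_def by (rule frac_in_circ)
  have y: "y \<in> circ" unfolding y_def using \<pi> u by (auto simp: bij_betw_def)
  define f where "f t = d y (frac (y + t))" for t
  define g where "g t = d y (\<pi> (frac (u + t)))" for t
  have "continuous_on UNIV (\<lambda>t. (\<lambda>t. d y (frac t)) (y + t))"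
    by (rule continuous_on_compose2[OF continuous_dissimilarity_frac[OF cont y]])
      (auto intro: continuous_intros)
  then have f: "continuous_on {0..1} f"
    unfolding f_def by (rule continuous_on_subset) simp
  have "d y y = 0"
    using d y by (auto simp: strict_circular_Robinson_def dissimilarity_def)
  then have f0: "f 0 = 0" "f 1 = 0"
    using y by (simp_all add: f_def frac_1_eq)
  \<comment> \<open>The antipode of \<open>y\<close> serves as the point where \<open>f\<close> is
    positive; any point other than \<open>y\<close> would do.\<close>
  have "frac (y + 1/2) \<noteq> y"
  proof
    assume "frac (y + 1/2) = y"
    then have "frac (y + 1/2) = frac y" using y by simp
    then have "(1/2 :: real) \<in> \<int>" by (simp add: frac_eq_frac_iff)
    then show False by simp
  qed
  then have f_half: "0 < f (1/2)"
    unfolding f_def using strict_circular_Robinson_pos[OF d y frac_in_circ] by metis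
  \<comment> \<open>The level is capped below \<open>f (1/2)\<close> so that it is attained on both
    sides of 1/2.\<close>
  define \<eta> where "\<eta> = min \<delta> (f (1/2) / 2)"
  have \<eta>: "0 < \<eta>" "\<eta> < f (1/2)" "\<eta> \<le> \<delta>"
    using f_half \<delta> by (auto simp: \<eta>_def)
  obtain s1 s2 where s: "0 < s1" "s1 < s2" "s2 < 1" "f s1 = \<eta>" "f s2 = \<eta>"
    using attains_small_values_twice[OF f f0 f_half _ _ \<eta>(1,2)] by auto
  \<comment> \<open>A preimage of \<open>y + a\<close> exists by surjectivity. It differs from
    \<open>u\<close> because \<open>a\<close> is not an integer, so its forward displacement from
    \<open>u\<close> lies strictly inside the unit interval.\<close>
  have pre: "\<exists>t. 0 < t \<and> t < 1 \<and> \<pi> (frac (u + t)) = frac (y + a)" if a: "0 < a" "a < 1" for a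
  proof -
    obtain v where v: "v \<in> circ" "\<pi> v = frac (y + a)"
      using \<pi> frac_in_circ[of "y + a"] by (metis bij_betw_def imageE)
    have "v \<noteq> u"
    proof
      assume "v = u"
      then have "frac (y + a) = frac y" using v y y_def by simp
      then have "a \<in> \<int>" by (simp add: frac_eq_frac_iff)
      then have "frac a = 0" by simp
      moreover have "frac a = a" using a by simp
      ultimately show False using a by simp
    qed
    moreover have "frac (u + frac (v - u)) = v" by (rule add_frac_diff[OF v(1)])
    ultimately have "frac (v - u) \<noteq> 0" using u by (metis add.right_neutral frac_circ)
    then have "0 < frac (v - u)" using frac_ge_0[of "v - u"] by linarith
    then show ?thesis
      using v \<open>frac (u + frac (v - u)) = v\<close> frac_lt_1 by metis
  qed
  obtain r1 r2 where r: "0 < r1" "r1 < 1" "0 < r2" "r2 < 1"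
    "\<pi> (frac (u + r1)) = frac (y + s1)" "\<pi> (frac (u + r2)) = frac (y + s2)"
    using pre[of s1] pre[of s2] s by auto
  have "r1 \<noteq> r2"
  proof
    assume "r1 = r2"
    then have "s1 - s2 \<in> \<int>"
      using r frac_eq_frac_iff[of "y + s1" "y + s2"] by simp
    then have "\<bar>s1 - s2\<bar> \<ge> 1" using s Ints_nonzero_abs_ge1[of "s1 - s2"] by simp
    then show False using s by simp
  qed
  \<comment> \<open>\<pi> may exchange the order of the two points, so the preimages are
    sorted.\<close>
  define t1 where "t1 = min r1 r2"
  define t2 where "t2 = max r1 r2"
  have t: "0 < t1" "t1 < t2" "t2 < 1" "g t1 = \<eta>" "g t2 = \<eta>"
    using r s \<open>r1 \<noteq> r2\<close> by (auto simp: t1_def t2_def min_def max_def g_def f_def)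
  have qc: "g b > min (g a) (g c)" if "0 < a" "a < b" "b < c" "c < 1" for a b c
    using strict_circular_Robinson_quasiconcave[OF e u that] by (simp add: g_def y_def)
  \<comment> \<open>For \<open>a < t1\<close>, quasi-concavity at \<open>a, t1, t2\<close> reads
    \<open>\<eta> > min (g a) \<eta>\<close>, which forces \<open>g a < \<eta>\<close>; beyond
    \<open>t2\<close> the argument is symmetric.\<close>
  have small: "g a < \<delta>" if "0 < a \<and> a < t1 \<or> t2 < a \<and> a < 1" for a
    using that qc[of a t1 t2] qc[of t1 t2 a] t \<eta> by (auto simp: min_def split: if_splits)
  show ?thesis
  proof (intro exI[of _ "min t1 (1 - t2)"] conjI allI impI)
    show "0 < min t1 (1 - t2)" using t by simp
    fix h assume h: "0 < \<bar>h\<bar> \<and> \<bar>h\<bar> < min t1 (1 - t2)"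
    \<comment> \<open>A backward displacement \<open>h\<close> is the forward displacement
      \<open>h + 1\<close>, which lies beyond \<open>t2\<close>.\<close>
    define a where "a = (if 0 < h then h else h + 1)"
    have "frac (u + a) = frac (x + h)"
      unfolding u_def frac_eq_frac_iff by (simp add: a_def frac_def)
    moreover have "g a < \<delta>"
      by (rule small) (use h in \<open>auto simp: a_def\<close>)
    ultimately show "d (\<pi> (frac x)) (\<pi> (frac (x + h))) < \<delta>"
      by (simp add: g_def y_def u_def)
  qed
qed


section \<open>Piecewise isometries\<close>

text \<open>The pieces are described on the real line, so that intervals may cross integers.
  Quantifying over all intervals that avoid \<open>F\<close> replaces an ordered list of
  breakpoints; nothing is asked at the exceptional points themselves.\<close>

definition piecewise_isometry :: "(real \<Rightarrow> real) \<Rightarrow> bool" where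
  "piecewise_isometry \<pi> \<longleftrightarrow> (\<exists>F. finite F \<and>
     (\<forall>a b. (\<forall>x\<in>{a<..<b}. frac x \<notin> F) \<longrightarrow>
       (\<exists>c. \<exists>\<sigma>\<in>{1, -1}. \<forall>x\<in>{a<..<b}. \<pi> (frac x) = frac (c + \<sigma> * x))))"

lemma piecewise_isometryI:
  assumes "finite F"
    and "\<And>a b. a < b \<Longrightarrow> (\<And>x. a < x \<Longrightarrow> x < b \<Longrightarrow> frac x \<notin> F) \<Longrightarrow>
      \<exists>c. \<exists>\<sigma>\<in>{1, -1}. \<forall>x\<in>{a<..<b}. \<pi> (frac x) = frac (c + \<sigma> * x)"
  shows "piecewise_isometry \<pi>"
  unfolding piecewise_isometry_def
proof (rule exI[of _ F], intro conjI allI impI)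
  fix a b :: real
  assume "\<forall>x\<in>{a<..<b}. frac x \<notin> F"
  then show "\<exists>c. \<exists>\<sigma>\<in>{1, -1}. \<forall>x\<in>{a<..<b}. \<pi> (frac x) = frac (c + \<sigma> * x)"
    using assms(2)[of a b] by (cases "a < b") auto
qed (rule assms(1))

lemma piecewise_isometry_affine:
  assumes "\<sigma> \<in> {1, -1}" "\<And>x. \<pi> (frac x) = frac (c + \<sigma> * x)"
  shows "piecewise_isometry \<pi>"
proof (rule piecewise_isometryI[of "{}"])
  fix a b :: real
  have "\<forall>x\<in>{a<..<b}. \<pi> (frac x) = frac (c + \<sigma> * x)"
    using assms(2) by simp
  then show "\<exists>c. \<exists>\<sigma>\<in>{1, -1}. \<forall>x\<in>{a<..<b}. \<pi> (frac x) = frac (c + \<sigma> * x)"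
    using assms(1) by blast
qed simp

lemma piecewise_isometry_id: "piecewise_isometry (\<lambda>x\<in>circ. x)"
  using frac_in_circ by (intro piecewise_isometry_affine[of 1 _ 0]) auto

lemma piecewise_isometry_rotation: "piecewise_isometry (rotation s)"
  by (rule piecewise_isometry_affine[of 1 _ s])
    (use frac_in_circ in \<open>auto simp: rotation_def add.commute\<close>)

lemma piecewise_isometry_reflection: "piecewise_isometry reflection"
  by (rule piecewise_isometry_affine[of "-1" _ 1])
    (use frac_in_circ in \<open>auto simp: reflection_def frac_diff_simp\<close>)

text \<open>The floor of \<open>x - t\<close> jumps only at points congruent to \<open>t\<close>
  modulo 1. If the values at \<open>x < y\<close> differed,
  \<open>t + \<lfloor>y - t\<rfloor>\<close> would be such a point in the interval.\<close>

lemma floor_diff_const: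
  fixes a b t :: real
  assumes "\<And>x. a < x \<Longrightarrow> x < b \<Longrightarrow> frac x \<noteq> frac t" "a < x" "x < b" "a < y" "y < b"
  shows "\<lfloor>x - t\<rfloor> = \<lfloor>y - t\<rfloor>"
  using assms(2-)
proof (induction x y rule: linorder_wlog)
  case (le x y)
  show ?case
  proof (rule ccontr)
    assume "\<lfloor>x - t\<rfloor> \<noteq> \<lfloor>y - t\<rfloor>"
    moreover have "\<lfloor>x - t\<rfloor> \<le> \<lfloor>y - t\<rfloor>" using le by (intro floor_mono) simp
    ultimately have "x - t < \<lfloor>y - t\<rfloor>" by (simp add: floor_less_iff[symmetric])
    moreover have "\<lfloor>y - t\<rfloor> \<le> y - t" by simp
    ultimately have "a < t + \<lfloor>y - t\<rfloor>" "t + \<lfloor>y - t\<rfloor> < b" using le by linarith+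
    then show False using assms(1)[of "t + \<lfloor>y - t\<rfloor>"] by simp
  qed
qed simp

lemma circ_arc_iff:
  assumes "x \<in> circ"
  shows "x \<in> circ_arc t s \<longleftrightarrow> 0 < frac (x - t) \<and> frac (x - t) < frac (s - t)"
proof
  assume "x \<in> circ_arc t s"
  then obtain u where u: "x = frac (t + u)" "0 < u" "u < frac (s - t)"
    by (auto simp: circ_arc_def)
  have "frac (x - t) = u"
    by (rule frac_eqI) (use u frac_lt_1[of "s - t"] in \<open>auto simp: frac_def\<close>)
  then show "0 < frac (x - t) \<and> frac (x - t) < frac (s - t)" using u by simp
next
  assume "0 < frac (x - t) \<and> frac (x - t) < frac (s - t)"
  then show "x \<in> circ_arc t s"
    using add_frac_diff[OF assms, of t] unfolding circ_arc_def
    by (intro CollectI exI[of _ "frac (x - t)"]) auto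
qed

text \<open>The endpoints of the arc are the only breakpoints: an interval avoiding them lies wholly
  inside the arc, where the map is \<open>s + t - x\<close> modulo 1, or wholly outside, where it is
  the identity.\<close>

lemma piecewise_isometry_arc_reversal: "piecewise_isometry (arc_reversal t s)"
proof (rule piecewise_isometryI[of "{frac t, frac s}"])
  fix a b :: real
  assume "a < b" and avoid: "\<And>x. a < x \<Longrightarrow> x < b \<Longrightarrow> frac x \<notin> {frac t, frac s}"
  \<comment> \<open>The midpoint merely samples the two floors, which are constant on the
    interval.\<close>
  define x0 where "x0 = (a + b) / 2"
  define n where "n = \<lfloor>x0 - t\<rfloor>"
  define m where "m = \<lfloor>x0 - s\<rfloor>"
  have x0: "a < x0" "x0 < b" using \<open>a < b\<close> by (auto simp: x0_def)
  have n: "\<lfloor>x - t\<rfloor> = n" if "a < x" "x < b" for x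
    unfolding n_def by (rule floor_diff_const[of a b]) (use avoid x0 that in auto)
  have m: "\<lfloor>x - s\<rfloor> = m" if "a < x" "x < b" for x
    unfolding m_def by (rule floor_diff_const[of a b]) (use avoid x0 that in auto)
  \<comment> \<open>With both floors fixed, \<open>frac (x - t) < frac (s - t)\<close> compares
    \<open>x - s\<close> with an integer, and this is decided by
    \<open>\<lfloor>x - s\<rfloor>\<close>; the criterion no longer mentions
    \<open>x\<close>.\<close>
  have arc: "frac x \<in> circ_arc t s \<longleftrightarrow> m < n - \<lfloor>s - t\<rfloor>" if x: "a < x" "x < b" for x
  proof -
    have 1: "frac (frac x - t) = frac (x - t)"
      by (rule frac_cong) (simp add: frac_def)
    have "frac (x - t) \<noteq> 0"
      using avoid[OF x] frac_eq_frac_iff[of x t] by auto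
    then have 2: "0 < frac (x - t)"
      using frac_ge_0[of "x - t"] by linarith
    have "frac (x - t) < frac (s - t) \<longleftrightarrow> x - s < of_int (n - \<lfloor>s - t\<rfloor>)"
      using n[OF x] by (simp add: frac_def) linarith
    also have "\<dots> \<longleftrightarrow> m < n - \<lfloor>s - t\<rfloor>"
      using m[OF x] by (metis floor_less_iff)
    finally show ?thesis
      using 1 2 by (simp only: circ_arc_iff[OF frac_in_circ] simp_thms)
  qed
  show "\<exists>c. \<exists>\<sigma>\<in>{1, -1}. \<forall>x\<in>{a<..<b}. arc_reversal t s (frac x) = frac (c + \<sigma> * x)"
  proof (cases "m < n - \<lfloor>s - t\<rfloor>")
    case True
    have "arc_reversal t s (frac x) = frac (s + t + -1 * x)" if x: "a < x" "x < b" for x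
    proof -
      have "arc_reversal t s (frac x) = frac (s - frac (frac x - t))"
        using arc[OF x] True frac_in_circ by (simp add: arc_reversal_def)
      also have "\<dots> = frac (s + t + -1 * x)"
        by (rule frac_cong) (simp add: frac_def)
      finally show ?thesis .
    qed
    then show ?thesis by (intro exI[of _ "s + t"] bexI[of _ "-1"]) auto
  next
    case False
    then have "arc_reversal t s (frac x) = frac (0 + 1 * x)" if "a < x" "x < b" for x
      using arc[OF that] frac_in_circ by (simp add: arc_reversal_def)
    then show ?thesis by (intro exI[of _ 0] bexI[of _ 1]) auto
  qed
qed simp

text \<open>The breakpoints of the composite are those of \<open>g\<close> and the preimages under
  \<open>g\<close> of those of \<open>f\<close>, finitely many since \<open>g\<close> is injective.
  Slopes multiply.\<close>

lemma piecewise_isometry_compose: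
  assumes "g \<in> Bij circ" "piecewise_isometry f" "piecewise_isometry g"
  shows "piecewise_isometry (compose circ f g)"
proof -
  obtain F where F: "finite F" "\<And>a b. (\<forall>x\<in>{a<..<b}. frac x \<notin> F) \<Longrightarrow>
       \<exists>c. \<exists>\<sigma>\<in>{1, -1}. \<forall>x\<in>{a<..<b}. f (frac x) = frac (c + \<sigma> * x)"
    using assms(2) unfolding piecewise_isometry_def by blast
  obtain G where G: "finite G" "\<And>a b. (\<forall>x\<in>{a<..<b}. frac x \<notin> G) \<Longrightarrow>
       \<exists>c. \<exists>\<sigma>\<in>{1, -1}. \<forall>x\<in>{a<..<b}. g (frac x) = frac (c + \<sigma> * x)"
    using assms(3) unfolding piecewise_isometry_def by blast
  have "inj_on g circ"
    using assms(1) by (simp add: Bij_def bij_betw_def)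
  show ?thesis
  proof (rule piecewise_isometryI[of "G \<union> (g -` F \<inter> circ)"])
    show "finite (G \<union> (g -` F \<inter> circ))"
      using G(1) finite_vimage_IntI[OF F(1) \<open>inj_on g circ\<close>] by simp
    fix a b :: real
    assume avoid: "\<And>x. a < x \<Longrightarrow> x < b \<Longrightarrow> frac x \<notin> G \<union> (g -` F \<inter> circ)"
    obtain c \<sigma> where g: "\<sigma> \<in> {1, -1}" "\<forall>x\<in>{a<..<b}. g (frac x) = frac (c + \<sigma> * x)"
      using G(2)[of a b] avoid by (meson UnI1 greaterThanLessThan_iff)
    \<comment> \<open>\<open>a'\<close> and \<open>b'\<close> bound the image of the interval under
      the affine piece of \<open>g\<close>; for slope -1 the endpoints change places.\<close>
    define a' where "a' = (if \<sigma> = 1 then c + a else c - b)"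
    define b' where "b' = (if \<sigma> = 1 then c + b else c - a)"
    have "frac z \<notin> F" if "z \<in> {a'<..<b'}" for z
    proof -
      \<comment> \<open>As \<open>\<sigma> * \<sigma> = 1\<close>, this inverts
        \<open>z = c + \<sigma> * x\<close>.\<close>
      define x where "x = \<sigma> * (z - c)"
      have "x \<in> {a<..<b}" "z = c + \<sigma> * x"
        using that g(1) by (auto simp: x_def a'_def b'_def algebra_simps)
      then show ?thesis
        using avoid[of x] g(2) frac_in_circ[of x] by auto
    qed
    then obtain c' \<tau> where f: "\<tau> \<in> {1, -1}" "\<forall>x\<in>{a'<..<b'}. f (frac x) = frac (c' + \<tau> * x)"
      using F(2)[of a' b'] by blast
    have "compose circ f g (frac x) = frac (c' + \<tau> * c + \<tau> * \<sigma> * x)" if x: "x \<in> {a<..<b}" for x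
    proof -
      have "c + \<sigma> * x \<in> {a'<..<b'}"
        using x g(1) by (auto simp: a'_def b'_def)
      then have "f (frac (c + \<sigma> * x)) = frac (c' + \<tau> * (c + \<sigma> * x))"
        using f(2) by blast
      then show ?thesis
        using g(2) x frac_in_circ[of x] by (simp add: compose_def algebra_simps)
    qed
    then show "\<exists>c. \<exists>\<sigma>\<in>{1, -1}. \<forall>x\<in>{a<..<b}. compose circ f g (frac x) = frac (c + \<sigma> * x)"
      using g(1) f(1) by (intro exI[of _ "c' + \<tau> * c"] bexI[of _ "\<tau> * \<sigma>"]) auto
  qed
qed

section \<open>Inverses of the generators, and passage to the generated groups\<close>

lemma Bij_circ_eqI:
  assumes "f \<in> Bij circ" "\<And>x. x \<in> circ \<Longrightarrow> f x = g x" "g \<in> extensional circ"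
  shows "f = g"
  using assms by (intro extensionalityI[of f circ]) (auto simp: Bij_def)

lemma compose_reflection_reflection: "compose circ reflection reflection = (\<lambda>x\<in>circ. x)"
proof (rule Bij_circ_eqI[OF compose_Bij[OF reflection_Bij reflection_Bij]])
  fix x :: real assume "x \<in> circ"
  moreover have "frac (1 - frac (1 - x)) = frac x"
    by (rule frac_cong) (simp add: frac_def)
  ultimately show "compose circ reflection reflection x = (\<lambda>x\<in>circ. x) x"
    using frac_in_circ by (simp add: compose_def reflection_def frac_lt_1)
qed simp

lemma compose_rotation_rotation: "compose circ (rotation (- s)) (rotation s) = (\<lambda>x\<in>circ. x)"
proof (rule Bij_circ_eqI[OF compose_Bij[OF rotation_Bij rotation_Bij]])
  fix x :: real assume "x \<in> circ"
  moreover have "frac (frac (x + s) - s) = frac x"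
    by (rule frac_cong) (simp add: frac_def)
  ultimately show "compose circ (rotation (- s)) (rotation s) x = (\<lambda>x\<in>circ. x) x"
    using frac_in_circ by (simp add: compose_def rotation_def frac_lt_1)
qed simp

lemma compose_arc_reversal_arc_reversal:
  "compose circ (arc_reversal t s) (arc_reversal t s) = (\<lambda>x\<in>circ. x)"
proof (rule Bij_circ_eqI[OF compose_Bij[OF arc_reversal_Bij arc_reversal_Bij]])
  fix x :: real assume x: "x \<in> circ"
  have "arc_reversal t s (arc_reversal t s x) = x"
  proof (cases "x \<in> circ_arc t s")
    case True
    then obtain u where u: "x = frac (t + u)" "0 < u" "u < frac (s - t)"
      by (auto simp: circ_arc_def)
    \<comment> \<open>\<open>v\<close> is the parameter of the mirror image of \<open>x\<close> in
      the arc.\<close>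
    define v where "v = frac (s - t) - u"
    have v: "0 < v" "v < frac (s - t)" using u by (auto simp: v_def)
    have 1: "frac (t + v) = frac (s - u)"
      by (rule frac_cong) (simp add: v_def frac_def)
    have 2: "frac (s - v) = frac (t + u)"
      by (rule frac_cong) (simp add: v_def frac_def)
    show ?thesis
      using arc_reversal_param[OF u(2,3)] arc_reversal_param[OF v] u(1) 1 2 by simp
  qed (use x in \<open>simp add: arc_reversal_def\<close>)
  then show "compose circ (arc_reversal t s) (arc_reversal t s) x = (\<lambda>x\<in>circ. x) x"
    using x by (simp add: compose_def)
qed simp

text \<open>Since \<open>generate\<close> also adds inverses of generators, each generator must come
  with a piecewise isometric left inverse, which uniqueness identifies with the group inverse.
  Inverses of general piecewise isometries are thus never analysed.\<close>

lemma piecewise_isometry_generate: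
  assumes H: "\<And>h. h \<in> H \<Longrightarrow> h \<in> Bij circ \<and> piecewise_isometry h \<and>
      (\<exists>h'\<in>Bij circ. piecewise_isometry h' \<and> compose circ h' h = (\<lambda>x\<in>circ. x))"
    and "\<pi> \<in> generate (BijGroup circ) H"
  shows "\<pi> \<in> Bij circ \<and> piecewise_isometry \<pi>"
  using assms(2)
proof induction
  case one
  then show ?case
    using id_Bij[of circ] piecewise_isometry_id by (simp add: BijGroup_def del: restrict_apply)
next
  case (incl h)
  then show ?case using H by blast
next
  case (inv h)
  then obtain h' where h': "h' \<in> Bij circ" "piecewise_isometry h'" "compose circ h' h = (\<lambda>x\<in>circ. x)"
    and h: "h \<in> Bij circ"
    using H by blast
  have "inv\<^bsub>BijGroup circ\<^esub> h = h'"
    by (rule group.inv_equality[OF group_BijGroup]) (use h h' in \<open>simp_all add: BijGroup_def\<close>)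
  then show ?case using h' by simp
next
  case (eng h1 h2)
  then show ?case
    by (simp add: BijGroup_def compose_Bij piecewise_isometry_compose)
qed

lemma Dih_infty_piecewise_isometry:
  assumes "\<rho> \<in> Dih_infty"
  shows "\<rho> \<in> Bij circ \<and> piecewise_isometry \<rho>"
proof (rule piecewise_isometry_generate[OF _ assms[unfolded Dih_infty_def]])
  fix h assume "h \<in> insert reflection (rotation ` circ)"
  then consider "h = reflection" | s where "h = rotation s" by blast
  then show "h \<in> Bij circ \<and> piecewise_isometry h \<and>
      (\<exists>h'\<in>Bij circ. piecewise_isometry h' \<and> compose circ h' h = (\<lambda>x\<in>circ. x))"
    by cases (use reflection_Bij rotation_Bij piecewise_isometry_reflection
        piecewise_isometry_rotation compose_reflection_reflection compose_rotation_rotation in metis)+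
qed

lemma Sym_infty_piecewise_isometry:
  assumes "\<pi> \<in> Sym_infty"
  shows "\<pi> \<in> Bij circ \<and> piecewise_isometry \<pi>"
proof -
  obtain \<rho> g where \<pi>: "\<pi> = compose circ \<rho> g" "\<rho> \<in> Dih_infty"
    and g: "g \<in> generate (BijGroup circ) {arc_reversal t s |t s. t \<in> circ \<and> s \<in> circ \<and> t \<noteq> s}"
    using assms unfolding Sym_infty_def by blast
  have "g \<in> Bij circ \<and> piecewise_isometry g"
  proof (rule piecewise_isometry_generate[OF _ g])
    fix h assume "h \<in> {arc_reversal t s |t s. t \<in> circ \<and> s \<in> circ \<and> t \<noteq> s}"
    then obtain t s where "h = arc_reversal t s" by blast
    then show "h \<in> Bij circ \<and> piecewise_isometry h \<and>
        (\<exists>h'\<in>Bij circ. piecewise_isometry h' \<and> compose circ h' h = (\<lambda>x\<in>circ. x))"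
      using arc_reversal_Bij piecewise_isometry_arc_reversal compose_arc_reversal_arc_reversal
      by metis
  qed
  then show ?thesis
    using \<pi> Dih_infty_piecewise_isometry compose_Bij piecewise_isometry_compose by metis
qed


section \<open>Gluing the pieces\<close>

text \<open>Only finitely many integer translates of points of \<open>F\<close> lie within distance
  1 of \<open>x\<close>. The neighbourhood is punctured because \<open>x\<close> may itself be a
  breakpoint.\<close>

lemma finite_frac_avoid:
  fixes x :: real
  assumes "finite F"
  shows "\<exists>\<epsilon>>0. \<forall>y. 0 < \<bar>y - x\<bar> \<and> \<bar>y - x\<bar> < \<epsilon> \<longrightarrow> frac y \<notin> F"
proof -
  define S where "S = (\<Union>p\<in>F. (+) p ` {k\<in>\<int>. x - p - 1 \<le> k \<and> k \<le> x - p + 1})"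
  have "finite S"
    unfolding S_def using assms finite_int_segment by blast
  then obtain \<epsilon> where \<epsilon>: "0 < \<epsilon>" "\<forall>y\<in>S. y \<noteq> x \<longrightarrow> \<epsilon> \<le> dist x y"
    using finite_set_avoid[of S x] by blast
  show ?thesis
  proof (intro exI[of _ "min \<epsilon> 1"] conjI allI impI notI)
    fix y assume y: "0 < \<bar>y - x\<bar> \<and> \<bar>y - x\<bar> < min \<epsilon> 1" and F: "frac y \<in> F"
    have "y = frac y + of_int \<lfloor>y\<rfloor>" by (simp add: frac_def)
    moreover have "of_int \<lfloor>y\<rfloor> \<in> {k\<in>\<int>. x - frac y - 1 \<le> k \<and> k \<le> x - frac y + 1}"
      using y by (auto simp: frac_def)
    ultimately have "y \<in> S" unfolding S_def using F by blast
    then show False using \<epsilon>(2) y by (auto simp: dist_real_def abs_minus_commute)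
  qed (use \<epsilon>(1) in auto)
qed

text \<open>By continuity the distances tend to \<open>d y (frac b)\<close>, so this value is 0, and
  positivity off the diagonal identifies the points. A general filter covers limits from the left
  and from the right.\<close>

lemma one_sided_limit_eq:
  assumes cont: "continuous_dissimilarity d" and d: "strict_circular_Robinson d"
    and y: "y \<in> circ"
    and lim: "((\<lambda>h. d y (\<phi> h)) \<longlongrightarrow> 0) F" and F: "F \<noteq> bot" "F \<le> nhds 0"
    and \<phi>: "\<forall>\<^sub>F h in F. \<phi> h = frac (b + \<sigma> * h)"
  shows "frac b = y"
proof -
  have "continuous_on UNIV (\<lambda>h. (\<lambda>t. d y (frac t)) (b + \<sigma> * h))"
    by (rule continuous_on_compose2[OF continuous_dissimilarity_frac[OF cont y]])
      (auto intro!: continuous_intros)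
  then have "isCont (\<lambda>h. d y (frac (b + \<sigma> * h))) 0"
    by (simp add: continuous_on_eq_continuous_at)
  then have "((\<lambda>h. d y (frac (b + \<sigma> * h))) \<longlongrightarrow> d y (frac b)) (nhds 0)"
    using tendsto_at_iff_tendsto_nhds[of "\<lambda>h. d y (frac (b + \<sigma> * h))" 0] by (simp add: isCont_def)
  then have "((\<lambda>h. d y (frac (b + \<sigma> * h))) \<longlongrightarrow> d y (frac b)) F"
    using F(2) by (rule tendsto_mono[rotated])
  moreover have "((\<lambda>h. d y (frac (b + \<sigma> * h))) \<longlongrightarrow> 0) F"
    using lim by (rule Lim_transform_eventually) (use \<phi> in \<open>auto elim: eventually_mono\<close>)
  ultimately have "d y (frac b) = 0"
    using F(1) tendsto_unique by blast
  then show ?thesis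
    using strict_circular_Robinson_pos[OF d y frac_in_circ[of b]] by fastforce
qed

definition local_isometry_at :: "(real \<Rightarrow> real) \<Rightarrow> real \<Rightarrow> real \<Rightarrow> bool" where
  "local_isometry_at \<pi> \<sigma> x \<longleftrightarrow>
     (\<exists>\<epsilon>>0. \<forall>h. \<bar>h\<bar> < \<epsilon> \<longrightarrow> \<pi> (frac (x + h)) = frac (\<pi> (frac x) + \<sigma> * h))"

text \<open>Both slopes together would make \<open>2 * h\<close> an integer for a small positive
  \<open>h\<close>; the bound 1/4 excludes this.\<close>

lemma local_isometry_at_unique:
  assumes "local_isometry_at \<pi> 1 x" "local_isometry_at \<pi> (-1) x"
  shows False
proof -
  obtain \<epsilon>1 \<epsilon>2 where \<epsilon>: "0 < \<epsilon>1" "0 < \<epsilon>2"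
    "\<And>h. \<bar>h\<bar> < \<epsilon>1 \<Longrightarrow> \<pi> (frac (x + h)) = frac (\<pi> (frac x) + 1 * h)"
    "\<And>h. \<bar>h\<bar> < \<epsilon>2 \<Longrightarrow> \<pi> (frac (x + h)) = frac (\<pi> (frac x) + -1 * h)"
    using assms unfolding local_isometry_at_def by blast
  define h where "h = min (1/4) (min \<epsilon>1 \<epsilon>2 / 2)"
  have h: "0 < h" "h \<le> 1/4" "h < \<epsilon>1" "h < \<epsilon>2" using \<epsilon>(1,2) by (auto simp: h_def)
  then have "frac (\<pi> (frac x) + 1 * h) = frac (\<pi> (frac x) + -1 * h)"
    using \<epsilon>(3)[of h] \<epsilon>(4)[of h] by simp
  then have "2 * h \<in> \<int>" by (simp add: frac_eq_frac_iff)
  then have "\<bar>2 * h\<bar> \<ge> 1" using h Ints_nonzero_abs_ge1[of "2 * h"] by simp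
  then show False using h by simp
qed

text \<open>Besides the slope, the intercept modulo 1 of the affine piece is locally constant, which
  prepares the connectedness argument.\<close>

lemma local_isometry_at_nearby:
  assumes "local_isometry_at \<pi> \<sigma> x"
  shows "\<forall>\<^sub>F y in nhds x. local_isometry_at \<pi> \<sigma> y \<and>
    frac (\<pi> (frac y) - \<sigma> * y) = frac (\<pi> (frac x) - \<sigma> * x)"
proof -
  obtain \<epsilon> where \<epsilon>: "0 < \<epsilon>" "\<And>h. \<bar>h\<bar> < \<epsilon> \<Longrightarrow> \<pi> (frac (x + h)) = frac (\<pi> (frac x) + \<sigma> * h)"
    using assms unfolding local_isometry_at_def by blast
  have "local_isometry_at \<pi> \<sigma> y \<and> frac (\<pi> (frac y) - \<sigma> * y) = frac (\<pi> (frac x) - \<sigma> * x)"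
    if y: "\<bar>y - x\<bar> < \<epsilon>" for y
  proof
    have 1: "\<pi> (frac y) = frac (\<pi> (frac x) + \<sigma> * (y - x))"
      using \<epsilon>(2)[of "y - x"] y by simp
    show "local_isometry_at \<pi> \<sigma> y" unfolding local_isometry_at_def
    proof (intro exI[of _ "\<epsilon> - \<bar>y - x\<bar>"] conjI allI impI)
      fix h assume h: "\<bar>h\<bar> < \<epsilon> - \<bar>y - x\<bar>"
      have "\<pi> (frac (y + h)) = frac (\<pi> (frac x) + \<sigma> * (y - x + h))"
        using \<epsilon>(2)[of "y - x + h"] h by (simp add: algebra_simps)
      also have "\<dots> = frac (\<pi> (frac y) + \<sigma> * h)"
        unfolding 1 by (rule frac_cong) (simp add: frac_def algebra_simps)
      finally show "\<pi> (frac (y + h)) = frac (\<pi> (frac y) + \<sigma> * h)" .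
    qed (use y in simp)
    show "frac (\<pi> (frac y) - \<sigma> * y) = frac (\<pi> (frac x) - \<sigma> * x)"
      unfolding 1 by (rule frac_cong) (simp add: frac_def algebra_simps)
  qed
  then show ?thesis
    unfolding eventually_nhds_metric dist_real_def using \<epsilon>(1) by blast
qed

text \<open>The pair of slope and intercept modulo 1 is a locally constant function on the connected
  real line, hence constant.\<close>

lemma local_isometry_global:
  assumes "\<And>x. local_isometry_at \<pi> 1 x \<or> local_isometry_at \<pi> (-1) x"
  shows "\<exists>c. \<exists>\<sigma>\<in>{1, -1}. \<forall>x. frac (\<pi> (frac x)) = frac (c + \<sigma> * x)"
proof -
  define S where "S x = (if local_isometry_at \<pi> 1 x then 1 else -1 :: real)" for x
  define f where "f x = (S x, frac (\<pi> (frac x) - S x * x))" for x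
  have S: "local_isometry_at \<pi> (S x) x" "S x \<in> {1, -1}" for x
    using assms[of x] by (auto simp: S_def)
  have S_eq: "S x = \<sigma>" if "local_isometry_at \<pi> \<sigma> x" "\<sigma> \<in> {1, -1}" for x \<sigma>
    using that local_isometry_at_unique[of \<pi> x] by (auto simp: S_def)
  have const: "f x = f 0" for x
  proof (rule connected_local_const[of UNIV x 0 f])
    show "\<forall>a\<in>UNIV. \<forall>\<^sub>F b in at a. f a = f b"
    proof
      fix a :: real
      have "\<forall>\<^sub>F b in nhds a. f a = f b"
        using local_isometry_at_nearby[OF S(1)[of a]]
      proof eventually_elim
        case (elim b)
        then have "S b = S a" using S_eq S(2) by blast
        then show ?case using elim by (simp add: f_def)
      qed
      then show "\<forall>\<^sub>F b in at a. f a = f b"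
        by (simp add: eventually_at_filter eventually_mono)
    qed
  qed auto
  define c where "c = \<pi> (frac 0)"
  have "frac (\<pi> (frac x)) = frac (c + S 0 * x)" for x
  proof -
    have "S x = S 0" "frac (\<pi> (frac x) - S x * x) = frac (c - S 0 * 0)"
      using const[of x] by (auto simp: f_def c_def)
    then show ?thesis by (simp add: frac_eq_frac_iff algebra_simps)
  qed
  then show ?thesis using S(2) by blast
qed

section \<open>Affine maps modulo 1 in the dihedral group, and the conclusion\<close>

lemma rotation_in_Dih_infty: "rotation c \<in> Dih_infty"
proof -
  have "frac (t + frac c) = frac (t + c)" for t
    by (rule frac_cong) (simp add: frac_def)
  then have "rotation c = rotation (frac c)"
    by (simp add: rotation_def)
  then show ?thesis
    unfolding Dih_infty_def using frac_in_circ[of c] by (metis generate.incl imageI insertI2)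
qed

lemma rotation_reflection_in_Dih_infty: "compose circ (rotation c) reflection \<in> Dih_infty"
proof -
  have "reflection \<in> Dih_infty"
    unfolding Dih_infty_def by (auto intro: generate.incl)
  then have "rotation c \<otimes>\<^bsub>BijGroup circ\<^esub> reflection \<in> Dih_infty"
    using rotation_in_Dih_infty[of c] unfolding Dih_infty_def by (rule generate.eng[rotated])
  then show ?thesis
    by (simp add: BijGroup_def rotation_Bij reflection_Bij)
qed

lemma affine_in_Dih_infty:
  assumes "\<pi> \<in> Bij circ" "\<sigma> \<in> {1, -1}" "\<And>x. x \<in> circ \<Longrightarrow> \<pi> x = frac (c + \<sigma> * x)"
  shows "\<pi> \<in> Dih_infty"
proof (cases "\<sigma> = 1")
  case True
  have "\<pi> = rotation c"
    by (rule Bij_circ_eqI[OF assms(1)])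
      (use assms(3) True in \<open>auto simp: rotation_def add.commute\<close>)
  then show ?thesis using rotation_in_Dih_infty by simp
next
  case False
  have "frac (frac (1 - x) + c) = frac (c - x)" for x
    by (rule frac_cong) (simp add: frac_def)
  then have "\<pi> = compose circ (rotation c) reflection"
    using assms False frac_in_circ
    by (intro Bij_circ_eqI[OF assms(1)])
      (auto simp: compose_def rotation_def reflection_def frac_lt_1)
  then show ?thesis using rotation_reflection_in_Dih_infty by simp
qed

theorem theorem6p2:
  fixes d :: "real \<Rightarrow> real \<Rightarrow> real" and \<pi> :: "real \<Rightarrow> real"
  assumes "continuous_dissimilarity d"
    and "strict_circular_Robinson d"
    and "\<pi> \<in> Sym_infty"
    and "strict_circular_Robinson (\<lambda>u v. d (\<pi> u) (\<pi> v))"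
  shows "\<pi> \<in> Dih_infty"
proof -
  have Bij: "\<pi> \<in> Bij circ" and pw: "piecewise_isometry \<pi>"
    using Sym_infty_piecewise_isometry[OF assms(3)] by auto
  then have bij: "bij_betw \<pi> circ circ" by (simp add: Bij_def)
  have circ: "\<pi> (frac x) \<in> circ" for x
    using bij frac_in_circ[of x] by (metis bij_betw_apply)
  obtain F where F: "finite F" "\<And>a b. (\<forall>x\<in>{a<..<b}. frac x \<notin> F) \<Longrightarrow>
       \<exists>c. \<exists>\<sigma>\<in>{1, -1}. \<forall>x\<in>{a<..<b}. \<pi> (frac x) = frac (c + \<sigma> * x)"
    using pw unfolding piecewise_isometry_def by blast
  have "local_isometry_at \<pi> 1 x \<or> local_isometry_at \<pi> (-1) x" for x
  proof -
    \<comment> \<open>Since \<open>x\<close> may be a breakpoint, the pieces to its left and right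
      are at first unrelated.\<close>
    obtain \<epsilon> where \<epsilon>: "0 < \<epsilon>" "\<And>y. 0 < \<bar>y - x\<bar> \<Longrightarrow> \<bar>y - x\<bar> < \<epsilon> \<Longrightarrow> frac y \<notin> F"
      using finite_frac_avoid[OF F(1), of x] by blast
    have off: "\<forall>y\<in>{x - \<epsilon><..<x}. frac y \<notin> F" "\<forall>y\<in>{x<..<x + \<epsilon>}. frac y \<notin> F"
      using \<epsilon>(2) by auto
    obtain c \<sigma> where l: "\<sigma> \<in> {1, -1}" "\<forall>y\<in>{x - \<epsilon><..<x}. \<pi> (frac y) = frac (c + \<sigma> * y)"
      using F(2)[of "x - \<epsilon>" x, OF off(1)] by blast
    obtain c' \<tau> where r: "\<tau> \<in> {1, -1}" "\<forall>y\<in>{x<..<x + \<epsilon>}. \<pi> (frac y) = frac (c' + \<tau> * y)"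
      using F(2)[of x "x + \<epsilon>", OF off(2)] by blast
    define y where "y = \<pi> (frac x)"
    have y: "y \<in> circ" unfolding y_def by (rule circ)
    have lim: "((\<lambda>h. d y (\<pi> (frac (x + h)))) \<longlongrightarrow> 0) (at 0)"
    proof (rule tendstoI)
      fix \<delta> :: real assume "0 < \<delta>"
      then obtain \<epsilon>' where "0 < \<epsilon>'"
        "\<And>h. 0 < \<bar>h\<bar> \<Longrightarrow> \<bar>h\<bar> < \<epsilon>' \<Longrightarrow> d y (\<pi> (frac (x + h))) < \<delta>"
        using strict_circular_Robinson_bij_vanishes[OF assms(1,2) bij assms(4), of \<delta> x]
        unfolding y_def by blast
      moreover have "0 \<le> d y (\<pi> (frac z))" for z
        using assms(2) y circ[of z] unfolding strict_circular_Robinson_def dissimilarity_def by blast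
      ultimately show "\<forall>\<^sub>F h in at 0. dist (d y (\<pi> (frac (x + h)))) 0 < \<delta>"
        unfolding eventually_at by (intro exI[of _ \<epsilon>']) (auto simp: dist_real_def)
    qed
    \<comment> \<open>Extended to \<open>x\<close>, each one-sided piece must take the value
      \<open>y\<close> modulo 1, so no jump occurs.\<close>
    have left: "frac (c + \<sigma> * x) = y"
    proof (rule one_sided_limit_eq[OF assms(1,2) y])
      show "((\<lambda>h. d y (\<pi> (frac (x + h)))) \<longlongrightarrow> 0) (at_left 0)"
        using lim by (rule tendsto_within_subset) simp
      show "\<forall>\<^sub>F h in at_left 0. \<pi> (frac (x + h)) = frac (c + \<sigma> * x + \<sigma> * h)"
        unfolding eventually_at using \<epsilon>(1) l(2)
        by (intro exI[of _ \<epsilon>]) (auto simp: dist_real_def algebra_simps)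
      show "at_left (0::real) \<noteq> bot" by simp
      show "at_left (0::real) \<le> nhds 0" by (simp add: at_within_def)
    qed
    have right: "frac (c' + \<tau> * x) = y"
    proof (rule one_sided_limit_eq[OF assms(1,2) y])
      show "((\<lambda>h. d y (\<pi> (frac (x + h)))) \<longlongrightarrow> 0) (at_right 0)"
        using lim by (rule tendsto_within_subset) simp
      show "\<forall>\<^sub>F h in at_right 0. \<pi> (frac (x + h)) = frac (c' + \<tau> * x + \<tau> * h)"
        unfolding eventually_at using \<epsilon>(1) r(2)
        by (intro exI[of _ \<epsilon>]) (auto simp: dist_real_def algebra_simps)
      show "at_right (0::real) \<noteq> bot" by simp
      show "at_right (0::real) \<le> nhds 0" by (simp add: at_within_def)
    qed
    have L: "\<pi> (frac (x + h)) = frac (y + \<sigma> * h)" if "- \<epsilon> < h" "h < 0" for h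
    proof -
      have "\<pi> (frac (x + h)) = frac (c + \<sigma> * (x + h))" using l(2) that by simp
      also have "\<dots> = frac (y + \<sigma> * h)"
        unfolding left[symmetric] by (rule frac_cong) (simp add: frac_def algebra_simps)
      finally show ?thesis .
    qed
    have R: "\<pi> (frac (x + h)) = frac (y + \<tau> * h)" if "0 < h" "h < \<epsilon>" for h
    proof -
      have "\<pi> (frac (x + h)) = frac (c' + \<tau> * (x + h))" using r(2) that by simp
      also have "\<dots> = frac (y + \<tau> * h)"
        unfolding right[symmetric] by (rule frac_cong) (simp add: frac_def algebra_simps)
      finally show ?thesis .
    qed
    \<comment> \<open>Opposite slopes would fold the circle at \<open>x\<close>, sending
      \<open>x + h\<close> and \<open>x - h\<close> to the same point against injectivity.\<close>
    have "\<sigma> = \<tau>"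
    proof (rule ccontr)
      assume "\<sigma> \<noteq> \<tau>"
      then have "\<sigma> = - \<tau>" using l(1) r(1) by auto
      define h where "h = min (1/4) (\<epsilon> / 2)"
      have h: "0 < h" "h \<le> 1/4" "h < \<epsilon>" using \<epsilon>(1) by (auto simp: h_def)
      have "\<pi> (frac (x + h)) = \<pi> (frac (x - h))"
        using L[of "- h"] R[of h] h \<open>\<sigma> = - \<tau>\<close> by simp
      then have "frac (x + h) = frac (x - h)"
        using bij frac_in_circ by (metis bij_betw_imp_inj_on inj_onD)
      then have "2 * h \<in> \<int>" by (simp add: frac_eq_frac_iff)
      then have "\<bar>2 * h\<bar> \<ge> 1" using h Ints_nonzero_abs_ge1[of "2 * h"] by simp
      then show False using h by simp
    qed
    have "\<pi> (frac (x + h)) = frac (y + \<sigma> * h)" if "\<bar>h\<bar> < \<epsilon>" for h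
    proof (cases h "0::real" rule: linorder_cases)
      case equal
      then show ?thesis using y by (simp add: y_def)
    qed (use that L R \<open>\<sigma> = \<tau>\<close> in auto)
    then have "local_isometry_at \<pi> \<sigma> x"
      unfolding local_isometry_at_def using \<epsilon>(1) y_def by blast
    then show ?thesis using l(1) by auto
  qed
  then obtain c \<sigma> where \<sigma>: "\<sigma> \<in> {1, -1}" "\<And>x. frac (\<pi> (frac x)) = frac (c + \<sigma> * x)"
    using local_isometry_global by blast
  have "\<pi> x = frac (c + \<sigma> * x)" if "x \<in> circ" for x
    using \<sigma>(2)[of x] circ[of x] that by simp
  then show ?thesis using affine_in_Dih_infty[OF Bij \<sigma>(1)] by blast
qed

end
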